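(* The formula $\mathrm{Rec}^{\aleph_0} P\rightarrow\mathrm{Rec} P$ is not uniformly valid.
   Context: Setting: Japaridze's computability logic. $P$ is an atom and $F\rightarrow G:=\neg F\vee G$. $\mathrm{Rec}A$ is the uncountable branching recurrence. Its legal runs consist of moves $w.\alpha$ ($w$ a finite bitstring) such that every thread $\Gamma^{\preceq x}$ ($x$ an infinite bitstring) is legal in $A$, and $\top$ wins iff it wins $A$ in every thread $x$. $\mathrm{Rec}^{\aleph_0}A$ is the countable branching recurrence: same legal runs, but $\top$ wins iff it wins $A$ in every thread indexed by an infinite bitstring with finitely many 1s. The duals are $\mathrm{Corec}A=\neg\mathrm{Rec}\neg A$ and $\mathrm{Corec}^{\aleph_0}A=\neg\mathrm{Rec}^{\aleph_0}\neg A$. A formula is uniformly valid iff one machine wins it under every interpretation of atoms as static games. *)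

theory Defs
  imports Main "HOL-Library.Infinite_Set"
begin

section \<open>Finite and infinite sequences\<close>

datatype 'a seq = Fin "'a list" | Inf "nat \<Rightarrow> 'a"

fun seq_at :: "'a seq \<Rightarrow> nat \<Rightarrow> 'a option" where
  "seq_at (Fin xs) i = (if i < length xs then Some (xs ! i) else None)"
| "seq_at (Inf f) i = Some (f i)"

definition seq_elems :: "'a seq \<Rightarrow> 'a set" where
  "seq_elems s = {a. \<exists>i. seq_at s i = Some a}"

fun init_seg :: "'a list \<Rightarrow> 'a seq \<Rightarrow> bool" where
  "init_seg xs (Fin ys) = (\<exists>zs. ys = xs @ zs)"
| "init_seg xs (Inf f) = (xs = map f [0..<length xs])"

text \<open>Deletes the entries on which \<^term>\<open>g\<close> is undefined and applies \<^term>\<open>g\<close> to the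
  others, keeping their order.\<close>

fun seq_map_filter :: "('a \<Rightarrow> 'b option) \<Rightarrow> 'a seq \<Rightarrow> 'b seq" where
  "seq_map_filter g (Fin xs) = Fin (List.map_filter g xs)"
| "seq_map_filter g (Inf f) =
    (let I = {i. g (f i) \<noteq> None} in
       if finite I then Fin (map (\<lambda>i. the (g (f i))) (sorted_list_of_set I))
       else Inf (\<lambda>k. the (g (f (enumerate I k)))))"


section \<open>Constant games\<close>

text \<open>\<^term>\<open>Machine\<close> is the player usually written \<open>\<top>\<close>, and
  \<^term>\<open>Environment\<close> is \<open>\<bottom>\<close>.\<close>

datatype player = Machine | Environment

fun opp :: "player \<Rightarrow> player" where
  "opp Machine = Environment"
| "opp Environment = Machine"

type_synonym move = string
type_synonym labmove = "player \<times> move"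
type_synonym position = "labmove list"
type_synonym run = "labmove seq"

text \<open>The values of \<open>Wn\<close> outside \<open>Lr\<close> carry no meaning; illegal runs are handled by \<open>won_by\<close>.\<close>

record game =
  Lr :: "run set"
  Wn :: "run \<Rightarrow> player"

definition constant_game :: "game \<Rightarrow> bool" where
  "constant_game A \<longleftrightarrow>
     (\<forall>\<Gamma>. \<Gamma> \<in> Lr A \<longleftrightarrow> (\<forall>\<Phi>. init_seg \<Phi> \<Gamma> \<and> \<Phi> \<noteq> [] \<longrightarrow> Fin \<Phi> \<in> Lr A))"

text \<open>Player \<^term>\<open>p\<close> made the last move of the shortest illegal initial segment.\<close>

definition illegal_by :: "game \<Rightarrow> player \<Rightarrow> run \<Rightarrow> bool" where
  "illegal_by A p \<Gamma> \<longleftrightarrow>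
     (\<exists>\<Phi> \<alpha>. init_seg (\<Phi> @ [(p, \<alpha>)]) \<Gamma> \<and> Fin \<Phi> \<in> Lr A \<and> Fin (\<Phi> @ [(p, \<alpha>)]) \<notin> Lr A)"

definition won_by :: "game \<Rightarrow> player \<Rightarrow> run \<Rightarrow> bool" where
  "won_by A p \<Gamma> \<longleftrightarrow> \<Gamma> \<in> Lr A \<and> Wn A \<Gamma> = p \<or> illegal_by A (opp p) \<Gamma>"


section \<open>Static games\<close>

definition moves_of :: "player \<Rightarrow> run \<Rightarrow> move seq" where
  "moves_of p \<Gamma> = seq_map_filter (\<lambda>(q, \<alpha>). if q = p then Some \<alpha> else None) \<Gamma>"

definition made_by :: "player \<Rightarrow> run \<Rightarrow> nat \<Rightarrow> bool" where
  "made_by p \<Gamma> i \<longleftrightarrow> (\<exists>\<alpha>. seq_at \<Gamma> i = Some (p, \<alpha>))"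

text \<open>Entry \<^term>\<open>i\<close> of the run is the \<^term>\<open>n\<close>-th move of \<^term>\<open>p\<close>, counting from 0.\<close>

definition nth_move_at :: "player \<Rightarrow> run \<Rightarrow> nat \<Rightarrow> nat \<Rightarrow> bool" where
  "nth_move_at p \<Gamma> n i \<longleftrightarrow> made_by p \<Gamma> i \<and> card {j. j < i \<and> made_by p \<Gamma> j} = n"

text \<open>The \<^term>\<open>n\<close>-th move of \<^term>\<open>p\<close> comes later than the \<^term>\<open>k\<close>-th move of its adversary.\<close>

definition later :: "player \<Rightarrow> run \<Rightarrow> nat \<Rightarrow> nat \<Rightarrow> bool" where
  "later p \<Gamma> n k \<longleftrightarrow>
     (\<exists>i j. nth_move_at p \<Gamma> n i \<and> nth_move_at (opp p) \<Gamma> k j \<and> j < i)"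

definition delay :: "player \<Rightarrow> run \<Rightarrow> run \<Rightarrow> bool" where
  "delay p \<Delta> \<Gamma> \<longleftrightarrow>
     (\<forall>q. moves_of q \<Delta> = moves_of q \<Gamma>) \<and> (\<forall>n k. later p \<Gamma> n k \<longrightarrow> later p \<Delta> n k)"

definition static :: "game \<Rightarrow> bool" where
  "static A \<longleftrightarrow> (\<forall>p \<Gamma> \<Delta>. delay p \<Delta> \<Gamma> \<and> won_by A p \<Gamma> \<longrightarrow> won_by A p \<Delta>)"


section \<open>Game operations\<close>

definition neg_run :: "run \<Rightarrow> run" where
  "neg_run = map_seq (\<lambda>(p, \<alpha>). (opp p, \<alpha>))"

definition neg_game :: "game \<Rightarrow> game" where
  "neg_game A = \<lparr>Lr = {\<Gamma>. neg_run \<Gamma> \<in> Lr A}, Wn = (\<lambda>\<Gamma>. opp (Wn A (neg_run \<Gamma>)))\<rparr>"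

definition project :: "(move \<Rightarrow> move option) \<Rightarrow> run \<Rightarrow> run" where
  "project g = seq_map_filter (\<lambda>(p, \<alpha>). map_option (Pair p) (g \<alpha>))"

definition strip :: "string \<Rightarrow> move \<Rightarrow> move option" where
  "strip u m = (if take (length u) m = u then Some (drop (length u) m) else None)"

definition component :: "string \<Rightarrow> run \<Rightarrow> run" where
  "component u = project (strip u)"

definition par_legal :: "game \<Rightarrow> game \<Rightarrow> run set" where
  "par_legal A B =
     {\<Gamma>. (\<forall>(p, m) \<in> seq_elems \<Gamma>. \<exists>\<alpha>. m = ''0.'' @ \<alpha> \<or> m = ''1.'' @ \<alpha>)
        \<and> component ''0.'' \<Gamma> \<in> Lr A \<and> component ''1.'' \<Gamma> \<in> Lr B}"

definition and_game :: "game \<Rightarrow> game \<Rightarrow> game" where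
  "and_game A B = \<lparr>Lr = par_legal A B,
     Wn = (\<lambda>\<Gamma>. if Wn A (component ''0.'' \<Gamma>) = Machine \<and> Wn B (component ''1.'' \<Gamma>) = Machine
               then Machine else Environment)\<rparr>"

definition or_game :: "game \<Rightarrow> game \<Rightarrow> game" where
  "or_game A B = \<lparr>Lr = par_legal A B,
     Wn = (\<lambda>\<Gamma>. if Wn A (component ''0.'' \<Gamma>) = Machine \<or> Wn B (component ''1.'' \<Gamma>) = Machine
               then Machine else Environment)\<rparr>"

type_synonym infbits = "nat \<Rightarrow> bool"

definition bits :: "infbits \<Rightarrow> nat \<Rightarrow> string" where
  "bits x n = map (\<lambda>i. if x i then CHR ''1'' else CHR ''0'') [0..<n]"

definition strip_thread :: "infbits \<Rightarrow> move \<Rightarrow> move option" where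
  "strip_thread x m =
     (if \<exists>n \<alpha>. m = bits x n @ CHR ''.'' # \<alpha>
      then Some (THE \<alpha>. \<exists>n. m = bits x n @ CHR ''.'' # \<alpha>) else None)"

lemma bits_dot_eq_iff:
  "bits x n @ CHR ''.'' # \<alpha> = bits x k @ CHR ''.'' # \<beta> \<longleftrightarrow> n = k \<and> \<alpha> = \<beta>"
proof
  assume eq: "bits x n @ CHR ''.'' # \<alpha> = bits x k @ CHR ''.'' # \<beta>"
  have nodot: "c \<noteq> CHR ''.''" if "c \<in> set (bits x i)" for c i
    using that by (auto simp: bits_def split: if_splits)
  have tw: "takeWhile (\<lambda>c. c \<noteq> CHR ''.'') (bits x i @ CHR ''.'' # \<gamma>) = bits x i" for i \<gamma>
    using nodot by (simp add: takeWhile_append2)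
  have same: "bits x n = bits x k"
    using tw[of n \<alpha>] tw[of k \<beta>] eq by (metis (full_types))
  have len: "length (bits x i) = i" for i
    by (simp add: bits_def)
  have "n = k" using arg_cong[OF same, of length] by (simp only: len)
  moreover have "\<alpha> = \<beta>" using eq unfolding same by (simp only: same_append_eq list.inject)
  ultimately show "n = k \<and> \<alpha> = \<beta>" by (rule conjI)
next
  assume "n = k \<and> \<alpha> = \<beta>"
  then show "bits x n @ CHR ''.'' # \<alpha> = bits x k @ CHR ''.'' # \<beta>" by (elim conjE) (simp only:)
qed

lemma strip_thread_eq_Some_iff:
  "strip_thread x m = Some \<alpha> \<longleftrightarrow> (\<exists>n. m = bits x n @ CHR ''.'' # \<alpha>)"
proof -
  have the: "strip_thread x m = Some \<beta>" if m: "m = bits x n @ CHR ''.'' # \<beta>" for n \<beta>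
  proof -
    have "(THE \<alpha>. \<exists>n. m = bits x n @ CHR ''.'' # \<alpha>) = \<beta>"
      unfolding m bits_dot_eq_iff by (rule the_equality) auto
    moreover have "\<exists>n \<alpha>. m = bits x n @ CHR ''.'' # \<alpha>"
      using m by blast
    ultimately show ?thesis
      unfolding strip_thread_def by (simp only: if_True)
  qed
  show ?thesis
  proof
    assume s: "strip_thread x m = Some \<alpha>"
    have "\<exists>n \<beta>. m = bits x n @ CHR ''.'' # \<beta>"
    proof (rule ccontr)
      assume "\<not> ?thesis"
      then have "strip_thread x m = None"
        unfolding strip_thread_def by (simp only: if_False)
      with s show False by (simp only: option.distinct)
    qed
    then obtain n \<beta> where m: "m = bits x n @ CHR ''.'' # \<beta>"
      by (elim exE)
    have "\<beta> = \<alpha>" using the[OF m] s by (simp only: option.inject)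
    with m show "\<exists>n. m = bits x n @ CHR ''.'' # \<alpha>" by (intro exI) (simp only:)
  next
    assume "\<exists>n. m = bits x n @ CHR ''.'' # \<alpha>"
    then show "strip_thread x m = Some \<alpha>" by (elim exE) (rule the)
  qed
qed

definition thread :: "infbits \<Rightarrow> run \<Rightarrow> run" where
  "thread x = project (strip_thread x)"

definition rec_legal :: "game \<Rightarrow> run set" where
  "rec_legal A =
     {\<Gamma>. (\<forall>(p, m) \<in> seq_elems \<Gamma>. \<exists>w \<alpha>. set w \<subseteq> {CHR ''0'', CHR ''1''} \<and> m = w @ CHR ''.'' # \<alpha>)
        \<and> (\<forall>x. thread x \<Gamma> \<in> Lr A)}"

definition rec_game :: "game \<Rightarrow> game" where
  "rec_game A = \<lparr>Lr = rec_legal A,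
     Wn = (\<lambda>\<Gamma>. if \<forall>x. Wn A (thread x \<Gamma>) = Machine then Machine else Environment)\<rparr>"

definition crec_game :: "game \<Rightarrow> game" where
  "crec_game A = \<lparr>Lr = rec_legal A,
     Wn = (\<lambda>\<Gamma>. if \<forall>x. finite {i. x i} \<longrightarrow> Wn A (thread x \<Gamma>) = Machine
               then Machine else Environment)\<rparr>"


section \<open>Hard-play machines\<close>

text \<open>A hard-play machine is a Turing machine with a read/write work tape and a read-only run
  tape, both infinite to the right. The run tape spells the current position. On entering
  a move state the machine makes the move spelled by the longest initial block of keyboard
  symbols on the work tape. In every step the environment may make any finite number of
  moves. There is no halting: a computation branch is always infinite.\<close>

datatype work_sym = Blank | Key char | Aux nat
datatype run_sym = RBlank | RLabel player | RKey char
datatype dir = GoLeft | Stay | GoRight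

record machine =
  states :: "nat set"
  start :: nat
  move_states :: "nat set"
  symbols :: "work_sym set"
  trans :: "nat \<Rightarrow> work_sym \<Rightarrow> run_sym \<Rightarrow> nat \<times> work_sym \<times> dir \<times> dir"

definition hpm :: "machine \<Rightarrow> bool" where
  "hpm M \<longleftrightarrow>
     finite (states M) \<and> start M \<in> states M \<and> move_states M \<subseteq> states M \<and>
     finite (symbols M) \<and> Blank \<in> symbols M \<and> range Key \<subseteq> symbols M \<and>
     (\<forall>s \<in> states M. \<forall>a \<in> symbols M. \<forall>r. trans M s a r \<in> states M \<times> symbols M \<times> UNIV \<times> UNIV)"

record config =
  state :: nat
  work :: "nat \<Rightarrow> work_sym"
  work_head :: nat
  run_head :: nat
  pos :: position

fun shift :: "dir \<Rightarrow> nat \<Rightarrow> nat" where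
  "shift GoLeft h = h - 1"
| "shift Stay h = h"
| "shift GoRight h = h + 1"

definition run_tape :: "position \<Rightarrow> nat \<Rightarrow> run_sym" where
  "run_tape \<Phi> i =
     (let t = concat (map (\<lambda>(p, \<alpha>). RLabel p # map RKey \<alpha>) \<Phi>)
      in if i < length t then t ! i else RBlank)"

definition spelled_move :: "(nat \<Rightarrow> work_sym) \<Rightarrow> move" where
  "spelled_move t = (THE \<alpha>. (\<forall>i < length \<alpha>. t i = Key (\<alpha> ! i)) \<and> t (length \<alpha>) \<notin> range Key)"

definition initial_config :: "machine \<Rightarrow> config" where
  "initial_config M =
     \<lparr>state = start M, work = (\<lambda>_. Blank), work_head = 0, run_head = 0, pos = []\<rparr>"

definition next_config :: "machine \<Rightarrow> move list \<Rightarrow> config \<Rightarrow> config" where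
  "next_config M \<beta>s c =
     (case trans M (state c) (work c (work_head c)) (run_tape (pos c) (run_head c)) of
        (s, a, d, e) \<Rightarrow>
          let t = (work c)(work_head c := a) in
          \<lparr>state = s, work = t, work_head = shift d (work_head c), run_head = shift e (run_head c),
           pos = pos c @ (if s \<in> move_states M then [(Machine, spelled_move t)] else [])
                       @ map (Pair Environment) \<beta>s\<rparr>)"

definition computation_branch :: "machine \<Rightarrow> (nat \<Rightarrow> config) \<Rightarrow> bool" where
  "computation_branch M C \<longleftrightarrow>
     C 0 = initial_config M \<and> (\<forall>n. \<exists>\<beta>s. C (Suc n) = next_config M \<beta>s (C n))"

definition spells :: "(nat \<Rightarrow> config) \<Rightarrow> run \<Rightarrow> bool" where
  "spells C \<Gamma> \<longleftrightarrow>
     (\<forall>i a. seq_at \<Gamma> i = Some a \<longleftrightarrow> (\<exists>n. i < length (pos (C n)) \<and> pos (C n) ! i = a))"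

definition wins :: "machine \<Rightarrow> game \<Rightarrow> bool" where
  "wins M A \<longleftrightarrow> (\<forall>C \<Gamma>. computation_branch M C \<and> spells C \<Gamma> \<longrightarrow> won_by A Machine \<Gamma>)"


section \<open>Formulas and uniform validity\<close>

datatype formula =
    Atom nat
  | Neg formula
  | And formula formula
  | Or formula formula
  | Rec formula
  | CRec formula

definition Imp :: "formula \<Rightarrow> formula \<Rightarrow> formula" where
  "Imp F G = Or (Neg F) G"

definition Corec :: "formula \<Rightarrow> formula" where
  "Corec F = Neg (Rec (Neg F))"

definition CCorec :: "formula \<Rightarrow> formula" where
  "CCorec F = Neg (CRec (Neg F))"

fun interp :: "(nat \<Rightarrow> game) \<Rightarrow> formula \<Rightarrow> game" where
  "interp I (Atom P) = I P"
| "interp I (Neg F) = neg_game (interp I F)"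
| "interp I (And F G) = and_game (interp I F) (interp I G)"
| "interp I (Or F G) = or_game (interp I F) (interp I G)"
| "interp I (Rec F) = rec_game (interp I F)"
| "interp I (CRec F) = crec_game (interp I F)"

definition interpretation_of_atoms :: "(nat \<Rightarrow> game) \<Rightarrow> bool" where
  "interpretation_of_atoms I \<longleftrightarrow> (\<forall>P. constant_game (I P) \<and> static (I P))"

definition uniformly_valid :: "formula \<Rightarrow> bool" where
  "uniformly_valid F \<longleftrightarrow>
     (\<exists>M. hpm M \<and> (\<forall>I. interpretation_of_atoms I \<longrightarrow> wins M (interp I F)))"

end

theory Submission
  imports Defs "HOL-Library.Countable_Set"
begin

text \<open>
  Against any machine, Environment ignores Machine and makes the move \<open>1.w.w\<close> for every
  bitstring \<open>w\<close>. In the consequent, the set of Environment's moves within thread \<open>x\<close> then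
  consists of the initial segments of \<open>x\<close>, so different threads have different move sets.
  The antecedent has only countably many relevant threads, so some thread \<open>x\<close> of the
  consequent has a move set shared by none of them. Since the interpretation may be chosen
  after the run is known, let \<open>P\<close> be the game that Machine loses iff Environment's moves
  form exactly that set. All runs of \<open>P\<close> are legal and its winner depends only on which
  moves Environment makes, so \<open>P\<close> is static.
\<close>

section \<open>Sets of labelled moves under projection and negation\<close>

lemma seq_elems_Fin [simp]: "seq_elems (Fin xs) = set xs"
  by (auto simp: seq_elems_def in_set_conv_nth)

lemma seq_elems_Inf [simp]: "seq_elems (Inf f) = range f"
  by (auto simp: seq_elems_def)

text \<open>Winner and legality in the games used below depend only on which labelled moves occur,
  so runs are followed through \<open>seq_elems\<close>, forgetting order and multiplicity.\<close>

lemma seq_elems_seq_map_filter: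
  "seq_elems (seq_map_filter g s) = {b. \<exists>a \<in> seq_elems s. g a = Some b}"
proof (cases s)
  case (Fin xs)
  then show ?thesis
    by (force simp: List.map_filter_def)
next
  case (Inf f)
  define I where "I = {i. g (f i) \<noteq> None}"
  have img: "(\<lambda>i. the (g (f i))) ` I = {b. \<exists>a \<in> seq_elems s. g a = Some b}"
    unfolding I_def Inf by (force simp: image_iff)
  show ?thesis
  proof (cases "finite I")
    case True
    then show ?thesis
      using Inf img by (simp add: I_def Let_def)
  next
    case False
    then have "range (\<lambda>k. the (g (f (enumerate I k)))) = (\<lambda>i. the (g (f i))) ` I"
      using range_enumerate[of I] by (metis image_image)
    with False show ?thesis
      using Inf img by (simp add: I_def Let_def)
  qed
qed

lemma seq_elems_project:
  "(p, \<beta>) \<in> seq_elems (project g \<Gamma>) \<longleftrightarrow> (\<exists>m. (p, m) \<in> seq_elems \<Gamma> \<and> g m = Some \<beta>)"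
  by (force simp: project_def seq_elems_seq_map_filter)

lemma strip_eq_Some_iff: "strip u m = Some \<alpha> \<longleftrightarrow> m = u @ \<alpha>"
  unfolding strip_def by (auto simp: append_eq_conv_conj) (metis append_take_drop_id)

lemma seq_elems_component:
  "(p, \<alpha>) \<in> seq_elems (component u \<Gamma>) \<longleftrightarrow> (p, u @ \<alpha>) \<in> seq_elems \<Gamma>"
  by (simp add: component_def seq_elems_project strip_eq_Some_iff)

lemma seq_elems_thread:
  "(p, \<alpha>) \<in> seq_elems (thread x \<Gamma>) \<longleftrightarrow> (\<exists>n. (p, bits x n @ CHR ''.'' # \<alpha>) \<in> seq_elems \<Gamma>)"
  by (auto simp: thread_def seq_elems_project strip_thread_eq_Some_iff)

lemma seq_elems_moves_of: "seq_elems (moves_of p \<Gamma>) = {\<alpha>. (p, \<alpha>) \<in> seq_elems \<Gamma>}"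
  by (force simp: moves_of_def seq_elems_seq_map_filter split: if_splits)

lemma seq_elems_neg_run:
  "seq_elems (neg_run \<Gamma>) = (\<lambda>(p, \<alpha>). (opp p, \<alpha>)) ` seq_elems \<Gamma>"
  by (cases \<Gamma>) (simp_all add: neg_run_def image_image)


section \<open>The interpretation of the atom and legality of moves\<close>

definition env_target_game :: "move set \<Rightarrow> game" where
  "env_target_game S = \<lparr>Lr = UNIV,
     Wn = (\<lambda>\<Gamma>. if seq_elems (moves_of Environment \<Gamma>) = S then Environment else Machine)\<rparr>"

lemma constant_game_env_target_game: "constant_game (env_target_game S)"
  by (simp add: constant_game_def env_target_game_def)

text \<open>A delay preserves \<open>moves_of\<close> for both players, and \<open>Wn\<close> reads
  nothing else; illegality cannot occur since \<open>Lr\<close> is \<open>UNIV\<close>.\<close>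

lemma static_env_target_game: "static (env_target_game S)"
  by (simp add: static_def delay_def won_by_def illegal_by_def env_target_game_def)

definition rec_move :: "move \<Rightarrow> bool" where
  "rec_move m \<longleftrightarrow> (\<exists>w \<alpha>. set w \<subseteq> {CHR ''0'', CHR ''1''} \<and> m = w @ CHR ''.'' # \<alpha>)"

lemma rec_legal_iff:
  assumes "Lr A = UNIV"
  shows "\<Gamma> \<in> rec_legal A \<longleftrightarrow> (\<forall>(p, m) \<in> seq_elems \<Gamma>. rec_move m)"
  using assms by (simp add: rec_legal_def rec_move_def)

text \<open>With no constraint coming from \<open>A\<close>, legality is a condition on each move
  separately. A well-formed move thus keeps a legal position legal, whatever Machine did
  before.\<close>

lemma par_legal_iff:
  assumes "Lr A = UNIV"
  shows "\<Gamma> \<in> par_legal (neg_game (crec_game A)) (rec_game A) \<longleftrightarrow>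
    (\<forall>(p, m) \<in> seq_elems \<Gamma>. \<exists>\<alpha>. rec_move \<alpha> \<and> (m = ''0.'' @ \<alpha> \<or> m = ''1.'' @ \<alpha>))"
proof -
  have neg: "(\<forall>(p, m) \<in> seq_elems (neg_run \<Delta>). rec_move m) \<longleftrightarrow>
      (\<forall>(p, m) \<in> seq_elems \<Delta>. rec_move m)" for \<Delta>
    by (auto simp: seq_elems_neg_run)
  have comp: "(\<forall>(p, m) \<in> seq_elems (component u \<Gamma>). rec_move m) \<longleftrightarrow>
      (\<forall>p \<alpha>. (p, u @ \<alpha>) \<in> seq_elems \<Gamma> \<longrightarrow> rec_move \<alpha>)" for u
    using seq_elems_component[of _ _ u \<Gamma>] by blast
  have "\<Gamma> \<in> par_legal (neg_game (crec_game A)) (rec_game A) \<longleftrightarrow>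
      (\<forall>(p, m) \<in> seq_elems \<Gamma>. \<exists>\<alpha>. m = ''0.'' @ \<alpha> \<or> m = ''1.'' @ \<alpha>) \<and>
      (\<forall>(p, m) \<in> seq_elems (component ''0.'' \<Gamma>). rec_move m) \<and>
      (\<forall>(p, m) \<in> seq_elems (component ''1.'' \<Gamma>). rec_move m)"
    by (simp add: par_legal_def neg_game_def crec_game_def rec_game_def neg rec_legal_iff[OF assms])
  also have "\<dots> \<longleftrightarrow>
      (\<forall>(p, m) \<in> seq_elems \<Gamma>. \<exists>\<alpha>. rec_move \<alpha> \<and> (m = ''0.'' @ \<alpha> \<or> m = ''1.'' @ \<alpha>))"
    unfolding comp by (auto; fastforce)
  finally show ?thesis .
qed


section \<open>Cardinality of sets of bitstrings, and recovery from prefixes\<close>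

lemma uncountable_infbits: "\<not> countable (UNIV :: infbits set)"
proof
  assume "countable (UNIV :: infbits set)"
  then have "range (from_nat_into (UNIV :: infbits set)) = UNIV"
    by (intro range_from_nat_into) auto
  \<comment> \<open>Cantor's diagonal sequence; listed at index \<open>i\<close>, it would disagree
    with itself at place \<open>i\<close>.\<close>
  then obtain i where "from_nat_into UNIV i = (\<lambda>n. \<not> from_nat_into (UNIV :: infbits set) n n)"
    by (metis (no_types, lifting) UNIV_I imageE)
  then show False
    by (metis (no_types, lifting))
qed

text \<open>These are the indicator functions of the finite sets of naturals.\<close>

lemma countable_finite_support: "countable {x :: infbits. finite {i. x i}}"
proof -
  have "{x :: infbits. finite {i. x i}} = (\<lambda>S i. i \<in> S) ` {S. finite S}"
    by (auto simp: image_iff intro!: exI[of _ "Collect _"])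
  then show ?thesis
    by (simp add: countable_Collect_finite)
qed

text \<open>The element of length \<open>n\<close> in \<open>range (bits x)\<close> is unique, so
  the set determines every prefix of \<open>x\<close>.\<close>

lemma inj_range_bits: "inj (\<lambda>x. range (bits x))"
proof
  fix x y :: infbits
  assume eq: "range (bits x) = range (bits y)"
  have "bits x n = bits y n" for n
  proof -
    obtain k where "bits x n = bits y k"
      using eq by blast
    moreover from this have "n = k"
      by (auto simp: bits_def dest: arg_cong[of _ _ length])
    ultimately show ?thesis
      by simp
  qed
  then show "x = y"
    by (fastforce simp: bits_def split: if_splits)
qed

text \<open>Bitstrings contain no dot, so the first dot splits the move uniquely and forces
  \<open>w = bits x n\<close>. Repeating the address as content is what makes threads
  distinguishable.\<close>

lemma word_move_in_thread:
  assumes "set w \<subseteq> {CHR ''0'', CHR ''1''}" "w @ CHR ''.'' # w = bits x n @ CHR ''.'' # \<alpha>"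
  shows "\<alpha> \<in> range (bits x)"
proof -
  have "CHR ''.'' \<notin> set w" "CHR ''.'' \<notin> set (bits x n)"
    using assms(1) by (auto simp: bits_def)
  then have "w = bits x n"
    using assms(2) by (metis append_Cons_eq_iff)
  with assms(2) show ?thesis
    by auto
qed


section \<open>Environment's fixed script and the run it produces\<close>

definition word_moves :: "nat \<Rightarrow> move list" where
  "word_moves n =
     map (\<lambda>w. ''1.'' @ w @ CHR ''.'' # w) (List.n_lists n [CHR ''0'', CHR ''1''])"

lemma set_word_moves:
  "set (word_moves n) =
     {''1.'' @ w @ CHR ''.'' # w |w. length w = n \<and> set w \<subseteq> {CHR ''0'', CHR ''1''}}"
  by (auto simp: word_moves_def set_n_lists)

lemma word_moves_not_Nil: "word_moves n \<noteq> []"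
proof -
  have "''1.'' @ replicate n CHR ''0'' @ CHR ''.'' # replicate n CHR ''0'' \<in> set (word_moves n)"
    unfolding set_word_moves by (intro CollectI exI[of _ "replicate n CHR ''0''"]) auto
  then show ?thesis
    by auto
qed

text \<open>Environment's batch depends on the step number only. For \<open>word_moves\<close>,
  sorting by length keeps each batch finite, as the machine model demands, and still reaches every
  bitstring.\<close>

fun oblivious_branch :: "machine \<Rightarrow> (nat \<Rightarrow> move list) \<Rightarrow> nat \<Rightarrow> config" where
  "oblivious_branch M \<beta> 0 = initial_config M"
| "oblivious_branch M \<beta> (Suc n) = next_config M (\<beta> n) (oblivious_branch M \<beta> n)"

lemma computation_branch_oblivious_branch: "computation_branch M (oblivious_branch M \<beta>)"
  by (auto simp: computation_branch_def)

lemma pos_oblivious_branch_Suc: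
  obtains \<Psi> where "set \<Psi> \<subseteq> {Machine} \<times> UNIV"
    "pos (oblivious_branch M \<beta> (Suc n)) =
       pos (oblivious_branch M \<beta> n) @ \<Psi> @ map (Pair Environment) (\<beta> n)"
proof (rule that)
  let ?c = "oblivious_branch M \<beta> n"
  let ?t = "trans M (state ?c) (work ?c (work_head ?c)) (run_tape (pos ?c) (run_head ?c))"
  let ?\<Psi> = "case ?t of (s, a, d, e) \<Rightarrow>
    if s \<in> move_states M then [(Machine, spelled_move ((work ?c)(work_head ?c := a)))] else []"
  show "set ?\<Psi> \<subseteq> {Machine} \<times> UNIV"
    by (auto split: prod.splits if_splits)
  show "pos (oblivious_branch M \<beta> (Suc n)) = pos ?c @ ?\<Psi> @ map (Pair Environment) (\<beta> n)"
    by (simp add: next_config_def Let_def split: prod.splits)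
qed

lemma environment_moves_oblivious_branch:
  "(Environment, m) \<in> set (pos (oblivious_branch M \<beta> n)) \<longleftrightarrow> (\<exists>k < n. m \<in> set (\<beta> k))"
proof (induction n)
  case 0
  then show ?case
    by (simp add: initial_config_def)
next
  case (Suc n)
  obtain \<Psi> where "set \<Psi> \<subseteq> {Machine} \<times> UNIV"
    "pos (oblivious_branch M \<beta> (Suc n)) =
       pos (oblivious_branch M \<beta> n) @ \<Psi> @ map (Pair Environment) (\<beta> n)"
    by (rule pos_oblivious_branch_Suc)
  then show ?case
    using Suc.IH by (auto simp: less_Suc_eq simp del: oblivious_branch.simps)
qed

text \<open>Nonempty batches make the positions outgrow every length, so their limit is an infinite
  run.\<close>

lemma oblivious_branch_spells:
  assumes "\<And>n. \<beta> n \<noteq> []"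
  obtains \<Gamma> where "spells (oblivious_branch M \<beta>) \<Gamma>"
    "\<And>m. (Environment, m) \<in> seq_elems \<Gamma> \<longleftrightarrow> (\<exists>n. m \<in> set (\<beta> n))"
proof -
  let ?p = "\<lambda>n. pos (oblivious_branch M \<beta> n)"
  \<comment> \<open>Step \<open>Suc i\<close> rather than \<open>i\<close>: the position there has
    length at least \<open>Suc i\<close>, so entry \<open>i\<close> exists.\<close>
  define f where "f i = ?p (Suc i) ! i" for i
  have ext: "\<exists>\<Psi>. \<Psi> \<noteq> [] \<and> ?p (Suc n) = ?p n @ \<Psi>" for n
    using assms[of n] by (metis pos_oblivious_branch_Suc Nil_is_append_conv Nil_is_map_conv)
  have len: "n \<le> length (?p n)" for n
  proof (induction n)
    case (Suc n)
    then show ?case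
      using ext[of n] by (auto simp del: oblivious_branch.simps simp: Suc_le_eq neq_Nil_conv)
  qed simp
  have prefix: "\<exists>\<Psi>. ?p (n + k) = ?p n @ \<Psi>" for n k
  proof (induction k)
    case (Suc k)
    then show ?case
      using ext[of "n + k"] by (auto simp del: oblivious_branch.simps)
  qed simp
  have agree: "?p n ! i = f i" if "i < length (?p n)" for n i
  proof -
    have "i < length (?p (Suc i))"
      using len[of "Suc i"] by simp
    \<comment> \<open>Of the two positions the earlier is a prefix of the later, so they share entry
      \<open>i\<close>.\<close>
    with that show ?thesis
      using prefix[of n "Suc i - n"] prefix[of "Suc i" "n - Suc i"] unfolding f_def
      by (cases "n \<le> Suc i") (auto simp: nth_append simp del: oblivious_branch.simps)
  qed
  have len': "i < length (?p (Suc i))" for i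
    using len[of "Suc i"] by simp
  have spells: "spells (oblivious_branch M \<beta>) (Inf f)"
    unfolding spells_def using agree len' by (metis option.inject seq_at.simps(2))
  have "range f = (\<Union>n. set (?p n))"
  proof
    show "range f \<subseteq> (\<Union>n. set (?p n))"
      unfolding f_def using len' by (meson UN_iff UNIV_I image_subsetI nth_mem)
    show "(\<Union>n. set (?p n)) \<subseteq> range f"
    proof
      fix a
      assume "a \<in> (\<Union>n. set (?p n))"
      then obtain n i where "i < length (?p n)" "a = ?p n ! i"
        unfolding UN_iff in_set_conv_nth by blast
      with agree show "a \<in> range f"
        by blast
    qed
  qed
  then have "(Environment, m) \<in> seq_elems (Inf f) \<longleftrightarrow> (\<exists>n. m \<in> set (\<beta> n))" for m
    by (auto simp: environment_moves_oblivious_branch)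
  with spells show ?thesis
    by (rule that)
qed


section \<open>Counting argument for a thread that Machine loses\<close>

theorem theorem5p1:
  fixes P :: nat
  shows "\<not> uniformly_valid (Imp (CRec (Atom P)) (Rec (Atom P)))"
proof
  assume "uniformly_valid (Imp (CRec (Atom P)) (Rec (Atom P)))"
  then obtain M where M: "\<And>I. interpretation_of_atoms I \<Longrightarrow>
      wins M (interp I (Imp (CRec (Atom P)) (Rec (Atom P))))"
    by (auto simp: uniformly_valid_def)
  \<comment> \<open>Uniformity enters here: \<open>M\<close>, and hence \<Gamma>, is fixed before
    any interpretation is chosen.\<close>
  obtain \<Gamma> where spells: "spells (oblivious_branch M word_moves) \<Gamma>"
    and env: "\<And>m. (Environment, m) \<in> seq_elems \<Gamma> \<longleftrightarrow> (\<exists>n. m \<in> set (word_moves n))"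
    using oblivious_branch_spells word_moves_not_Nil by metis
  \<comment> \<open>\<open>neg_run\<close> swaps the labels, so \<open>T y\<close> consists of the
    moves made by Machine in thread \<open>y\<close> of the antecedent.\<close>
  define T where
    "T y = seq_elems (moves_of Environment (thread y (neg_run (component ''0.'' \<Gamma>))))" for y
  \<comment> \<open>By injectivity the left side is uncountable, whereas finitely supported
    \<open>y\<close> yield only countably many sets \<open>T y\<close>.\<close>
  have "\<not> range (\<lambda>x. range (bits x)) \<subseteq> T ` {y. finite {i. y i}}"
  proof
    assume "range (\<lambda>x. range (bits x)) \<subseteq> T ` {y. finite {i. y i}}"
    then have "countable (range (\<lambda>x. range (bits x)))"
      using countable_finite_support by (metis countable_image countable_subset)
    then show False
      using countable_image_inj_on[OF _ inj_range_bits] uncountable_infbits by blast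
  qed
  then obtain x where x: "\<And>y. finite {i. y i} \<Longrightarrow> T y \<noteq> range (bits x)"
    by blast
  let ?A = "env_target_game (range (bits x))"
  let ?G = "or_game (neg_game (crec_game ?A)) (rec_game ?A)"
  have Lr_A: "Lr ?A = UNIV"
    by (simp add: env_target_game_def)
  have thread_x: "seq_elems (moves_of Environment (thread x (component ''1.'' \<Gamma>))) = range (bits x)"
  proof -
    have "(\<exists>n. (Environment, ''1.'' @ bits x n @ CHR ''.'' # \<alpha>) \<in> seq_elems \<Gamma>) \<longleftrightarrow> \<alpha> \<in> range (bits x)"
      for \<alpha>
    proof
      assume "\<exists>n. (Environment, ''1.'' @ bits x n @ CHR ''.'' # \<alpha>) \<in> seq_elems \<Gamma>"
      then obtain n w where "set w \<subseteq> {CHR ''0'', CHR ''1''}"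
        "w @ CHR ''.'' # w = bits x n @ CHR ''.'' # \<alpha>"
        by (auto simp: env set_word_moves eq_commute)
      then show "\<alpha> \<in> range (bits x)"
        by (rule word_move_in_thread)
    next
      assume "\<alpha> \<in> range (bits x)"
      then obtain n where n: "\<alpha> = bits x n"
        by blast
      have "length (bits x n) = n" "set (bits x n) \<subseteq> {CHR ''0'', CHR ''1''}"
        by (auto simp: bits_def)
      then have "''1.'' @ bits x n @ CHR ''.'' # \<alpha> \<in> set (word_moves n)"
        unfolding set_word_moves n by blast
      then show "\<exists>n. (Environment, ''1.'' @ bits x n @ CHR ''.'' # \<alpha>) \<in> seq_elems \<Gamma>"
        using env by blast
    qed
    then show ?thesis
      unfolding seq_elems_moves_of seq_elems_thread seq_elems_component by blast
  qed
  have "Wn ?A (thread x (component ''1.'' \<Gamma>)) = Environment"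
    by (simp add: env_target_game_def thread_x)
  then have "Wn (rec_game ?A) (component ''1.'' \<Gamma>) = Environment"
    by (auto simp: rec_game_def intro!: exI[of _ x])
  \<comment> \<open>Roles are swapped in the antecedent: a \<open>crec_game\<close> won in all
    relevant threads is a lost negation.\<close>
  moreover have "Wn ?A (thread y (neg_run (component ''0.'' \<Gamma>))) = Machine"
    if "finite {i. y i}" for y
    using x[OF that] by (simp add: env_target_game_def T_def)
  then have "Wn (neg_game (crec_game ?A)) (component ''0.'' \<Gamma>) = Environment"
    by (simp add: neg_game_def crec_game_def)
  ultimately have Wn: "Wn ?G \<Gamma> = Environment"
    by (simp add: or_game_def)
  \<comment> \<open>\<open>won_by\<close> would also credit Machine if Environment made the first
    illegal move, so this must be excluded.\<close>
  have "\<not> illegal_by ?G Environment \<Gamma>"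
  proof
    assume "illegal_by ?G Environment \<Gamma>"
    then obtain \<Phi> m where seg: "init_seg (\<Phi> @ [(Environment, m)]) \<Gamma>"
      and legal: "Fin \<Phi> \<in> Lr ?G" and illegal: "Fin (\<Phi> @ [(Environment, m)]) \<notin> Lr ?G"
      by (auto simp: illegal_by_def)
    have "(Environment, m) \<in> seq_elems \<Gamma>"
    proof (cases \<Gamma>)
      case (Inf f)
      then have "set (\<Phi> @ [(Environment, m)]) \<subseteq> range f"
        using seg by (metis image_mono init_seg.simps(2) set_map subset_UNIV)
      with Inf show ?thesis
        by simp
    qed (use seg in auto)
    then obtain w where w: "set w \<subseteq> {CHR ''0'', CHR ''1''}" "m = ''1.'' @ w @ CHR ''.'' # w"
      by (auto simp: env set_word_moves)
    then have "rec_move (w @ CHR ''.'' # w)"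
      unfolding rec_move_def by blast
    with legal illegal w(2) show False
      by (auto simp: or_game_def par_legal_iff[OF Lr_A])
  qed
  with Wn have "\<not> won_by ?G Machine \<Gamma>"
    by (simp add: won_by_def)
  moreover have "interpretation_of_atoms (\<lambda>_. ?A)"
    by (simp add: interpretation_of_atoms_def constant_game_env_target_game static_env_target_game)
  then have "wins M ?G"
    using M[of "\<lambda>_. ?A"] by (simp add: Imp_def)
  ultimately show False
    using computation_branch_oblivious_branch spells unfolding wins_def by blast
qed

end
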